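(* (i) Every inverse limit of an inverse system of regular finite tree sets is a regular tree set. (ii) Every regular profinite tree set is isomorphic to the inverse limit of an inverse system of regular finite tree sets.
   Context: A separation system $(\vec S,\le,{}^* )$ is a partially ordered set with an order-reversing involution $\vec s\mapsto \vec s^{\,*}=:\overleftarrow s$. For $\vec s\in\vec S$ the set $s=\{\vec s,\overleftarrow s\}$ is an (unoriented) separation. An element $\vec s$ is degenerate if $\vec s=\overleftarrow s$, and small if $\vec s\le\overleftarrow s$; a separation system is regular if it has no small element. Two unoriented separations $r,s$ are nested if some orientation of $r$ is $\le$ some orientation of $s$; a separation system is nested if any two of its separations are nested. $\vec r$ is trivial if there is an unoriented separation $s$ with $\vec r<\vec s$ and $\vec r<\overleftarrow s$ (strictly). A tree set is a nested separation system without degenerate and without trivial elements. A homomorphism $f\colon\vec R\to\vec S$ satisfies $f(\overleftarrow r)=(f(\vec r))^*$ and $f(\vec r_1)\le f(\vec r_2)$ whenever $\vec r_1\le\vec r_2$; an isomorphism is a bijective homomorphism whose inverse is a homomorphism. An inverse system of finite separation systems consists of a directed poset $P$, finite separation systems $\vec S_p$ ($p\in P$) and homomorphisms $f_{qp}\colon\vec S_q\to\vec S_p$ ($p\le q$) with $f_{pp}=\mathrm{id}$ and $f_{qp}\circ f_{tq}=f_{tp}$. Its inverse limit is the set of families $(\vec s_p)_{p\in P}$ with $f_{qp}(\vec s_q)=\vec s_p$ for all $p\le q$, ordered coordinatewise, with coordinatewise involution. A separation system is profinite if it is isomorphic to such an inverse limit. *)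

theory Defs
  imports "HOL-Library.FuncSet"
begin

record 'a sepsys =
  seps :: "'a set"
  sep_le :: "'a \<Rightarrow> 'a \<Rightarrow> bool" (infix "\<sqsubseteq>\<index>" 50)
  star :: "'a \<Rightarrow> 'a"

definition separation_system :: "'a sepsys \<Rightarrow> bool" where
  "separation_system S \<longleftrightarrow>
     reflp_on (seps S) (sep_le S) \<and> transp_on (seps S) (sep_le S) \<and> antisymp_on (seps S) (sep_le S) \<and>
     (\<forall>s\<in>seps S. star S s \<in> seps S \<and> star S (star S s) = s) \<and>
     (\<forall>r\<in>seps S. \<forall>s\<in>seps S. r \<sqsubseteq>\<^bsub>S\<^esub> s \<longrightarrow> star S s \<sqsubseteq>\<^bsub>S\<^esub> star S r)"

definition sep_less :: "'a sepsys \<Rightarrow> 'a \<Rightarrow> 'a \<Rightarrow> bool" where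
  "sep_less S r s \<longleftrightarrow> r \<sqsubseteq>\<^bsub>S\<^esub> s \<and> r \<noteq> s"

definition unoriented :: "'a sepsys \<Rightarrow> 'a \<Rightarrow> 'a set" where
  "unoriented S s = {s, star S s}"

definition degenerate :: "'a sepsys \<Rightarrow> 'a \<Rightarrow> bool" where
  "degenerate S s \<longleftrightarrow> s = star S s"

definition small :: "'a sepsys \<Rightarrow> 'a \<Rightarrow> bool" where
  "small S s \<longleftrightarrow> s \<sqsubseteq>\<^bsub>S\<^esub> star S s"

definition trivial :: "'a sepsys \<Rightarrow> 'a \<Rightarrow> bool" where
  "trivial S r \<longleftrightarrow> (\<exists>s\<in>seps S. sep_less S r s \<and> sep_less S r (star S s))"

definition regular :: "'a sepsys \<Rightarrow> bool" where
  "regular S \<longleftrightarrow> (\<forall>s\<in>seps S. \<not> small S s)"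

definition nested_seps :: "'a sepsys \<Rightarrow> 'a set \<Rightarrow> 'a set \<Rightarrow> bool" where
  "nested_seps S r s \<longleftrightarrow> (\<exists>r'\<in>r. \<exists>s'\<in>s. r' \<sqsubseteq>\<^bsub>S\<^esub> s')"

definition nested :: "'a sepsys \<Rightarrow> bool" where
  "nested S \<longleftrightarrow> (\<forall>r\<in>seps S. \<forall>s\<in>seps S. nested_seps S (unoriented S r) (unoriented S s))"

definition tree_set :: "'a sepsys \<Rightarrow> bool" where
  "tree_set S \<longleftrightarrow> separation_system S \<and> nested S \<and>
     (\<forall>s\<in>seps S. \<not> degenerate S s \<and> \<not> trivial S s)"

definition sep_hom :: "'a sepsys \<Rightarrow> 'b sepsys \<Rightarrow> ('a \<Rightarrow> 'b) \<Rightarrow> bool" where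
  "sep_hom R S f \<longleftrightarrow> f \<in> seps R \<rightarrow> seps S \<and>
     (\<forall>r\<in>seps R. f (star R r) = star S (f r)) \<and>
     (\<forall>r\<in>seps R. \<forall>r'\<in>seps R. r \<sqsubseteq>\<^bsub>R\<^esub> r' \<longrightarrow> f r \<sqsubseteq>\<^bsub>S\<^esub> f r')"

definition isomorphic :: "'a sepsys \<Rightarrow> 'b sepsys \<Rightarrow> bool" where
  "isomorphic R S \<longleftrightarrow>
     (\<exists>f. bij_betw f (seps R) (seps S) \<and> sep_hom R S f \<and> sep_hom S R (inv_into (seps R) f))"

text \<open>
  As usual, directed posets are nonempty. Without this, the one-point limit over the empty
  poset would be a degenerate limit of a (vacuous) system of regular tree sets.
\<close>

definition directed_poset :: "'i set \<Rightarrow> ('i \<Rightarrow> 'i \<Rightarrow> bool) \<Rightarrow> bool" where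
  "directed_poset P le \<longleftrightarrow> P \<noteq> {} \<and>
     reflp_on P le \<and> transp_on P le \<and> antisymp_on P le \<and>
     (\<forall>p\<in>P. \<forall>q\<in>P. \<exists>t\<in>P. le p t \<and> le q t)"

text \<open>
  The bonding map from \<open>S q\<close> to \<open>S p\<close>, for \<open>p\<close> below \<open>q\<close>, is \<open>f q p\<close>. Taking all the \<open>S p\<close> over
  one ambient type \<open>'b\<close> is no restriction, since \<open>'b\<close> is arbitrary and the carriers vary with \<open>p\<close>.
\<close>

definition inverse_system ::
    "'i set \<Rightarrow> ('i \<Rightarrow> 'i \<Rightarrow> bool) \<Rightarrow> ('i \<Rightarrow> 'b sepsys) \<Rightarrow> ('i \<Rightarrow> 'i \<Rightarrow> 'b \<Rightarrow> 'b) \<Rightarrow> bool" where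
  "inverse_system P le S f \<longleftrightarrow> directed_poset P le \<and>
     (\<forall>p\<in>P. separation_system (S p) \<and> finite (seps (S p))) \<and>
     (\<forall>p\<in>P. \<forall>q\<in>P. le p q \<longrightarrow> sep_hom (S q) (S p) (f q p)) \<and>
     (\<forall>p\<in>P. \<forall>x\<in>seps (S p). f p p x = x) \<and>
     (\<forall>p\<in>P. \<forall>q\<in>P. \<forall>t\<in>P. le p q \<longrightarrow> le q t \<longrightarrow>
        (\<forall>x\<in>seps (S t). f q p (f t q x) = f t p x))"

text \<open>
  Families indexed by \<open>P\<close> are extensional functions, i.e. \<open>undefined\<close> outside \<open>P\<close>, so that
  they are determined by their coordinates in \<open>P\<close>.
\<close>

definition inverse_limit ::
    "'i set \<Rightarrow> ('i \<Rightarrow> 'i \<Rightarrow> bool) \<Rightarrow> ('i \<Rightarrow> 'b sepsys) \<Rightarrow> ('i \<Rightarrow> 'i \<Rightarrow> 'b \<Rightarrow> 'b) \<Rightarrow> ('i \<Rightarrow> 'b) sepsys" where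
  "inverse_limit P le S f =
     \<lparr>seps = {x \<in> \<Pi>\<^sub>E p\<in>P. seps (S p). \<forall>p\<in>P. \<forall>q\<in>P. le p q \<longrightarrow> f q p (x q) = x p},
      sep_le = (\<lambda>x y. \<forall>p\<in>P. x p \<sqsubseteq>\<^bsub>S p\<^esub> y p),
      star = (\<lambda>x. \<lambda>p\<in>P. star (S p) (x p))\<rparr>"

text \<open>
  HOL cannot quantify over types inside a formula, so the types of the indices and of the
  elements of the finite systems are parameters. A hypothesis \<open>profinite TYPE('i) TYPE('b) S\<close> in
  a theorem with \<open>'i\<close> and \<open>'b\<close> free thus covers inverse systems over arbitrary types.
\<close>

definition profinite :: "'i itself \<Rightarrow> 'b itself \<Rightarrow> 'a sepsys \<Rightarrow> bool" where
  "profinite _ _ T \<longleftrightarrow>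
     (\<exists>(P :: 'i set) le (S :: 'i \<Rightarrow> 'b sepsys) f.
        inverse_system P le S f \<and> isomorphic T (inverse_limit P le S f))"

end

theory Submission
  imports Defs "HOL-Analysis.Abstract_Topological_Spaces"
begin

text \<open>
  In a regular separation system nothing is trivial or degenerate: from \<open>r \<le> s\<close> and
  \<open>r \<le> s\<^sup>*\<close> one gets \<open>r \<le> s \<le> r\<^sup>*\<close>, so \<open>r\<close> is small. Hence the regular tree sets are exactly the
  regular nested separation systems. Nestedness and regularity pass to inverse limits, the former
  because two separations have only four pairs of orientations and the index set is directed.

  Conversely, let a regular tree set be the limit of a system \<open>(S\<^sub>p)\<close>. If every \<open>S\<^sub>p\<close> had a
  small element, then by compactness so would the limit. So some \<open>S\<^sub>p\<close> is regular, and then so are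
  all \<open>S\<^sub>q\<close> with \<open>q \<ge> p\<close>. Replacing these \<open>S\<^sub>q\<close> by the projections of the limit, which
  are nested, does not change the limit.
\<close>

section \<open>Directed index sets\<close>

lemma directed_posetD:
  assumes "directed_poset P le"
  shows "P \<noteq> {}" "\<And>p. p \<in> P \<Longrightarrow> le p p"
    "\<And>p q t. \<lbrakk>le p q; le q t; p \<in> P; q \<in> P; t \<in> P\<rbrakk> \<Longrightarrow> le p t"
    "\<And>p q. \<lbrakk>p \<in> P; q \<in> P\<rbrakk> \<Longrightarrow> \<exists>t\<in>P. le p t \<and> le q t"
  using assms unfolding directed_poset_def reflp_on_def transp_on_def by blast+

lemma directed_poset_finite_bound:
  assumes P: "directed_poset P le" and "finite A" "A \<subseteq> P"
  shows "\<exists>t\<in>P. \<forall>p\<in>A. le p t"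
  using \<open>finite A\<close> \<open>A \<subseteq> P\<close>
proof induction
  case empty
  then show ?case using directed_posetD(1)[OF P] by blast
next
  case (insert a A)
  then obtain t where t: "t \<in> P" "\<forall>p\<in>A. le p t" by blast
  then obtain u where u: "u \<in> P" "le a u" "le t u"
    using directed_posetD(4)[OF P, of a t] insert.prems by blast
  then show ?case
    using t directed_posetD(3)[OF P] insert.prems by (metis insert_iff subset_iff)
qed

text \<open>A bound in \<open>P\<close> of two elements above \<open>p\<close> is above
  \<open>p\<close> by transitivity. Such an up-set will serve as the new, cofinal index set.\<close>

lemma directed_poset_above:
  assumes P: "directed_poset P le" and "p \<in> P"
  shows "directed_poset {q \<in> P. le p q} le"
proof -
  have "\<exists>t\<in>{q \<in> P. le p q}. le q t \<and> le r t"
    if "q \<in> {q \<in> P. le p q}" "r \<in> {q \<in> P. le p q}" for q r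
    using directed_posetD(4)[OF P, of q r] directed_posetD(3)[OF P] that \<open>p \<in> P\<close>
    by (metis (lifting) mem_Collect_eq)
  moreover have "p \<in> {q \<in> P. le p q}"
    using directed_posetD(2)[OF P] \<open>p \<in> P\<close> by simp
  ultimately show ?thesis
    using P unfolding directed_poset_def
    by (auto simp: reflp_on_def intro: transp_on_subset antisymp_on_subset)
qed

section \<open>Compactness for inverse limits of finite sets\<close>

text \<open>A product of finite discrete spaces is compact, and each compatibility condition cuts
  out a closed subset. Any finitely many conditions hold together: take one element of
  \<open>X t\<close>, for \<open>t\<close> above all indices involved, and send it down.\<close>

lemma finite_inverse_limit_nonempty:
  assumes P: "directed_poset P le"
    and fin: "\<And>p. p \<in> P \<Longrightarrow> finite (X p)" and ne: "\<And>p. p \<in> P \<Longrightarrow> X p \<noteq> {}"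
    and maps: "\<And>p q x. \<lbrakk>p \<in> P; q \<in> P; le p q; x \<in> X q\<rbrakk> \<Longrightarrow> f q p x \<in> X p"
    and comp: "\<And>p q t x. \<lbrakk>p \<in> P; q \<in> P; t \<in> P; le p q; le q t; x \<in> X t\<rbrakk> \<Longrightarrow>
                 f q p (f t q x) = f t p x"
  obtains x where "x \<in> (\<Pi>\<^sub>E p\<in>P. X p)"
    "\<And>p q. \<lbrakk>p \<in> P; q \<in> P; le p q\<rbrakk> \<Longrightarrow> f q p (x q) = x p"
proof -
  define T where "T = product_topology (\<lambda>p. discrete_topology (X p)) P"
  define C where "C = (\<lambda>(p, q). {x \<in> topspace T. f q p (x q) = x p})"
  define I where "I = {(p, q). p \<in> P \<and> q \<in> P \<and> le p q}"
  have top: "topspace T = (\<Pi>\<^sub>E p\<in>P. X p)"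
    by (simp add: T_def)
  have "compact_space T"
    unfolding T_def compact_space_product_topology
    using fin by (auto simp: compact_space_def compactin_discrete_topology)
  have closed: "closedin T (C i)" if i: "i \<in> I" for i
  proof -
    obtain p q where pq: "i = (p, q)" "p \<in> P" "q \<in> P" "le p q"
      using i by (auto simp: I_def)
    have cont: "continuous_map T (discrete_topology (X r)) (\<lambda>x. x r)" if "r \<in> P" for r
      unfolding T_def using that by (rule continuous_map_product_projection)
    have "continuous_map (discrete_topology (X q)) (discrete_topology (X p)) (f q p)"
      using maps pq by auto
    then have "continuous_map T (discrete_topology (X p)) (\<lambda>x. f q p (x q))"
      using continuous_map_compose[OF cont[OF pq(3)], of _ "f q p"] by (simp add: o_def)
    \<comment> \<open>\<open>C (p, q)\<close> is the set on which two continuous maps into a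
      Hausdorff space agree.\<close>
    then show ?thesis
      using closedin_continuous_maps_eq[OF Hausdorff_space_discrete_topology _ cont[OF pq(2)]]
      by (simp add: C_def pq(1))
  qed
  have fip: "topspace T \<inter> \<Inter>\<F> \<noteq> {}" if "finite \<F>" and sub: "\<F> \<subseteq> C ` I" for \<F>
  proof -
    obtain J where J: "finite J" "J \<subseteq> I" "\<F> = C ` J"
      using finite_subset_image[OF \<open>finite \<F>\<close> sub] by blast
    \<comment> \<open>It suffices to bound the upper indices \<open>q\<close> of the pairs in
      \<open>J\<close>; the lower ones then follow by transitivity.\<close>
    have "\<exists>t\<in>P. \<forall>p\<in>snd ` J. le p t"
      by (rule directed_poset_finite_bound[OF P]) (use J in \<open>auto simp: I_def\<close>)
    then obtain t where t: "t \<in> P" "\<And>p q. (p, q) \<in> J \<Longrightarrow> le q t"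
      by force
    obtain a where a: "a \<in> X t" using ne t(1) by blast
    \<comment> \<open>Coordinates at indices not below \<open>t\<close> are arbitrary: no condition
      in \<open>J\<close> involves them.\<close>
    define x where "x = (\<lambda>p\<in>P. if le p t then f t p a else SOME b. b \<in> X p)"
    have "x \<in> topspace T"
      using t(1) a maps ne by (auto simp: top x_def some_in_eq)
    moreover have "f q p (x q) = x p" if "(p, q) \<in> J" for p q
    proof -
      have "p \<in> P" "q \<in> P" "le p q" "le q t"
        using that J t(2) by (auto simp: I_def)
      then show ?thesis
        using comp a t(1) directed_posetD(3)[OF P] by (auto simp: x_def)
    qed
    ultimately have "x \<in> topspace T \<inter> \<Inter>\<F>"
      by (auto simp: J C_def)
    then show ?thesis by blast
  qed
  have "compactin T (topspace T)"
    using \<open>compact_space T\<close> by (simp add: compact_space_def)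
  note compactness = this[unfolded compactin_fip, THEN conjunct2, THEN spec, THEN mp]
  have "topspace T \<inter> \<Inter>(C ` I) \<noteq> {}"
  proof (rule compactness, intro conjI ballI allI)
    show "closedin T D" if "D \<in> C ` I" for D
      using that closed by blast
    show "finite \<F> \<and> \<F> \<subseteq> C ` I \<longrightarrow> topspace T \<inter> \<Inter>\<F> \<noteq> {}" for \<F>
      using fip[of \<F>] by simp
  qed
  then obtain x where x: "x \<in> topspace T" "x \<in> \<Inter>(C ` I)" by blast
  have "f q p (x q) = x p" if "p \<in> P" "q \<in> P" "le p q" for p q
  proof -
    have "x \<in> C (p, q)"
      using x(2) that by (simp add: I_def)
    then show ?thesis by (simp add: C_def)
  qed
  with x(1) show thesis
    unfolding top by (rule that)
qed

section \<open>Separation systems, homomorphisms and isomorphisms\<close>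

lemma separation_systemD:
  assumes "separation_system S"
  shows "\<And>x. x \<in> seps S \<Longrightarrow> sep_le S x x"
    "\<And>x y z. \<lbrakk>sep_le S x y; sep_le S y z; x \<in> seps S; y \<in> seps S; z \<in> seps S\<rbrakk> \<Longrightarrow> sep_le S x z"
    "\<And>x y. \<lbrakk>sep_le S x y; sep_le S y x; x \<in> seps S; y \<in> seps S\<rbrakk> \<Longrightarrow> x = y"
    "\<And>x. x \<in> seps S \<Longrightarrow> star S x \<in> seps S"
    "\<And>x. x \<in> seps S \<Longrightarrow> star S (star S x) = x"
    "\<And>x y. \<lbrakk>sep_le S x y; x \<in> seps S; y \<in> seps S\<rbrakk> \<Longrightarrow> sep_le S (star S y) (star S x)"
  using assms unfolding separation_system_def reflp_on_def transp_on_def antisymp_on_def by blast+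

lemma separation_system_subset:
  assumes S: "separation_system S" and "A \<subseteq> seps S" "\<And>x. x \<in> A \<Longrightarrow> star S x \<in> A"
  shows "separation_system (S\<lparr>seps := A\<rparr>)"
  using assms unfolding separation_system_def
  by (auto intro: reflp_on_subset transp_on_subset antisymp_on_subset simp: subset_iff)

lemma regular_nested_tree_set:
  assumes S: "separation_system S" and "nested S" and reg: "regular S"
  shows "tree_set S"
proof -
  note D = separation_systemD[OF S]
  have "\<not> trivial S r" if "r \<in> seps S" for r
  proof
    assume "trivial S r"
    then obtain s where s: "s \<in> seps S" "sep_le S r s" "sep_le S r (star S s)"
      by (auto simp: trivial_def sep_less_def)
    \<comment> \<open>The involution turns \<open>r \<sqsubseteq> star S s\<close> into
      this.\<close>
    then have "sep_le S s (star S r)"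
      using D(4-6) that by metis
    then have "small S r"
      using s that D(2,4) unfolding small_def by blast
    then show False using reg that by (simp add: regular_def)
  qed
  \<comment> \<open>For \<open>s = star S s\<close>, reflexivity already makes \<open>s\<close>
    small.\<close>
  moreover have "\<not> degenerate S s" if "s \<in> seps S" for s
    using reg that D(1) by (metis degenerate_def regular_def small_def)
  ultimately show ?thesis
    using assms by (simp add: tree_set_def)
qed

lemma sep_homD:
  assumes "sep_hom R S f"
  shows "\<And>x. x \<in> seps R \<Longrightarrow> f x \<in> seps S"
    "\<And>x. x \<in> seps R \<Longrightarrow> f (star R x) = star S (f x)"
    "\<And>x y. \<lbrakk>sep_le R x y; x \<in> seps R; y \<in> seps R\<rbrakk> \<Longrightarrow> sep_le S (f x) (f y)"
  using assms unfolding sep_hom_def by blast+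

lemma small_hom:
  assumes "sep_hom R S f" "separation_system R" "x \<in> seps R" "small R x"
  shows "small S (f x)"
  using assms sep_homD[OF assms(1)] separation_systemD(4)[OF assms(2)]
  unfolding small_def by metis

text \<open>A homomorphism commutes with the involution, so it maps orientations of \<open>r\<close>
  to orientations of the image of \<open>r\<close>, and it preserves the inequality between two of
  them. The lemma is applied both to isomorphisms and to the projections of a limit.\<close>

lemma nested_hom_image:
  assumes f: "sep_hom R S f" and R: "separation_system R" "nested R"
  shows "nested (S\<lparr>seps := f ` seps R\<rparr>)"
  unfolding nested_def
proof (clarsimp)
  fix r s assume rs: "r \<in> seps R" "s \<in> seps R"
  then obtain r' s' where "r' \<in> {r, star R r}" "s' \<in> {s, star R s}" "sep_le R r' s'"
    using R(2) unfolding nested_def nested_seps_def unoriented_def by blast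
  moreover from this have "sep_le S (f r') (f s')"
    using sep_homD(3)[OF f] separation_systemD(4)[OF R(1)] rs by blast
  ultimately show "nested_seps (S\<lparr>seps := f ` seps R\<rparr>) (unoriented (S\<lparr>seps := f ` seps R\<rparr>) (f r))
      (unoriented (S\<lparr>seps := f ` seps R\<rparr>) (f s))"
    using rs sep_homD(2)[OF f] by (auto simp: nested_seps_def unoriented_def)
qed

text \<open>The inverse of a bijective homomorphism commutes with the involution automatically; that
  it is monotone means that \<open>f\<close> reflects the order. This form avoids
  \<open>inv_into\<close>.\<close>

lemma isomorphic_iff:
  assumes R: "separation_system R"
  shows "isomorphic R S \<longleftrightarrow>
    (\<exists>f. bij_betw f (seps R) (seps S) \<and> (\<forall>r\<in>seps R. f (star R r) = star S (f r)) \<and>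
         (\<forall>r\<in>seps R. \<forall>r'\<in>seps R. sep_le R r r' \<longleftrightarrow> sep_le S (f r) (f r')))"
    (is "_ \<longleftrightarrow> (\<exists>f. ?emb f)")
proof -
  have "bij_betw f (seps R) (seps S) \<and> sep_hom R S f \<and> sep_hom S R (inv_into (seps R) f) \<longleftrightarrow> ?emb f"
    for f
  proof (cases "bij_betw f (seps R) (seps S)")
    case True
    let ?g = "inv_into (seps R) f"
    have gf: "?g (f r) = r" if "r \<in> seps R" for r
      using True that by (simp add: bij_betw_inv_into_left)
    have im: "seps S = f ` seps R" and mem: "f \<in> seps R \<rightarrow> seps S"
      using True by (auto simp: bij_betw_def)
    have "sep_hom S R ?g \<longleftrightarrow>
        (\<forall>r\<in>seps R. \<forall>r'\<in>seps R. sep_le S (f r) (f r') \<longrightarrow> sep_le R r r')"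
      if st: "\<forall>r\<in>seps R. f (star R r) = star S (f r)"
    proof -
      have "?g (star S (f r)) = star R r" if "r \<in> seps R" for r
        using st gf that separation_systemD(4)[OF R] by metis
      then show ?thesis
        by (auto simp: sep_hom_def im gf)
    qed
    then show ?thesis
      using True mem unfolding sep_hom_def[of R S] by blast
  qed simp
  then show ?thesis unfolding isomorphic_def by auto
qed

lemma isomorphic_trans:
  assumes R: "separation_system R" and S: "separation_system S"
    and "isomorphic R S" "isomorphic S T"
  shows "isomorphic R T"
proof -
  obtain f where f: "bij_betw f (seps R) (seps S)" "\<forall>r\<in>seps R. f (star R r) = star S (f r)"
      "\<forall>r\<in>seps R. \<forall>r'\<in>seps R. sep_le R r r' \<longleftrightarrow> sep_le S (f r) (f r')"
    using assms(3) isomorphic_iff[OF R] by metis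
  obtain g where g: "bij_betw g (seps S) (seps T)" "\<forall>r\<in>seps S. g (star S r) = star T (g r)"
      "\<forall>r\<in>seps S. \<forall>r'\<in>seps S. sep_le S r r' \<longleftrightarrow> sep_le T (g r) (g r')"
    using assms(4) isomorphic_iff[OF S] by metis
  have "f r \<in> seps S" if "r \<in> seps R" for r
    using f(1) that by (simp add: bij_betw_apply)
  then show ?thesis
    unfolding isomorphic_iff[OF R]
    using f(2,3) g(2,3) bij_betw_trans[OF f(1) g(1)] by (intro exI[of _ "g \<circ> f"]) simp
qed

section \<open>Inverse limits as separation systems\<close>

lemma inverse_systemD:
  assumes "inverse_system P le S f"
  shows "directed_poset P le"
    "\<And>p. p \<in> P \<Longrightarrow> separation_system (S p)"
    "\<And>p. p \<in> P \<Longrightarrow> finite (seps (S p))"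
    "\<And>p q. \<lbrakk>p \<in> P; q \<in> P; le p q\<rbrakk> \<Longrightarrow> sep_hom (S q) (S p) (f q p)"
    "\<And>p x. \<lbrakk>p \<in> P; x \<in> seps (S p)\<rbrakk> \<Longrightarrow> f p p x = x"
    "\<And>p q t x. \<lbrakk>p \<in> P; q \<in> P; t \<in> P; le p q; le q t; x \<in> seps (S t)\<rbrakk> \<Longrightarrow>
       f q p (f t q x) = f t p x"
  using assms unfolding inverse_system_def by blast+

lemma seps_inverse_limit:
  "x \<in> seps (inverse_limit P le S f) \<longleftrightarrow>
     x \<in> (\<Pi>\<^sub>E p\<in>P. seps (S p)) \<and> (\<forall>p\<in>P. \<forall>q\<in>P. le p q \<longrightarrow> f q p (x q) = x p)"
  by (simp add: inverse_limit_def)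

lemma le_inverse_limit:
  "sep_le (inverse_limit P le S f) x y \<longleftrightarrow> (\<forall>p\<in>P. sep_le (S p) (x p) (y p))"
  by (simp add: inverse_limit_def)

lemma star_inverse_limit:
  "star (inverse_limit P le S f) x = (\<lambda>p\<in>P. star (S p) (x p))"
  by (simp add: inverse_limit_def)

lemma separation_system_inverse_limit:
  assumes sys: "inverse_system P le S f"
  shows "separation_system (inverse_limit P le S f)"
proof -
  let ?L = "inverse_limit P le S f"
  note D = separation_systemD[OF inverse_systemD(2)[OF sys]]
  note H = sep_homD[OF inverse_systemD(4)[OF sys]]
  have mem: "x p \<in> seps (S p)" if "x \<in> seps ?L" "p \<in> P" for x p
    using that by (auto simp: seps_inverse_limit)
  have "reflp_on (seps ?L) (sep_le ?L)"
    by (auto simp: reflp_on_def le_inverse_limit mem D(1))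
  moreover have "transp_on (seps ?L) (sep_le ?L)"
    unfolding transp_on_def le_inverse_limit by (meson mem D(2))
  \<comment> \<open>Members of the limit are extensional, so agreement of all coordinates in
    \<open>P\<close> gives equality.\<close>
  moreover have "x = y"
    if "x \<in> seps ?L" "y \<in> seps ?L" "sep_le ?L x y" "sep_le ?L y x" for x y
  proof (rule PiE_ext)
    show "x \<in> (\<Pi>\<^sub>E p\<in>P. seps (S p))" "y \<in> (\<Pi>\<^sub>E p\<in>P. seps (S p))"
      using that by (simp_all add: seps_inverse_limit)
  qed (use that mem D(3) in \<open>auto simp: le_inverse_limit\<close>)
  then have "antisymp_on (seps ?L) (sep_le ?L)"
    by (auto simp: antisymp_on_def)
  moreover have "star ?L x \<in> seps ?L" if "x \<in> seps ?L" for x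
    unfolding seps_inverse_limit star_inverse_limit
    using that mem D(4) H(2) by (auto simp: seps_inverse_limit)
  moreover have "star ?L (star ?L x) = x" if "x \<in> seps ?L" for x
  proof (rule PiE_ext)
    show "x \<in> (\<Pi>\<^sub>E p\<in>P. seps (S p))"
      using that by (simp add: seps_inverse_limit)
  qed (use that mem D(4,5) in \<open>auto simp: star_inverse_limit\<close>)
  moreover have "sep_le ?L (star ?L y) (star ?L x)"
    if "x \<in> seps ?L" "y \<in> seps ?L" "sep_le ?L x y" for x y
    using that mem D(6) by (auto simp: le_inverse_limit star_inverse_limit)
  ultimately show ?thesis
    unfolding separation_system_def by blast
qed

lemma sep_hom_projection:
  assumes "p \<in> P"
  shows "sep_hom (inverse_limit P le S f) (S p) (\<lambda>x. x p)"
  using assms by (auto simp: sep_hom_def seps_inverse_limit star_inverse_limit le_inverse_limit)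

section \<open>Regularity and nestedness of the limit\<close>

text \<open>Projections preserve smallness, so a single coordinate refutes a small element. The
  nonempty index set supplies that coordinate.\<close>

lemma regular_inverse_limit:
  assumes sys: "inverse_system P le S f" and reg: "\<And>p. p \<in> P \<Longrightarrow> regular (S p)"
  shows "regular (inverse_limit P le S f)"
proof -
  obtain p where p: "p \<in> P"
    using directed_posetD(1)[OF inverse_systemD(1)[OF sys]] by blast
  have "small (S p) (x p)" "x p \<in> seps (S p)"
    if "x \<in> seps (inverse_limit P le S f)" "small (inverse_limit P le S f) x" for x
    using that p small_hom[OF sep_hom_projection[OF p] separation_system_inverse_limit[OF sys]]
      sep_homD(1)[OF sep_hom_projection[OF p]] by blast+
  then show ?thesis
    using reg[OF p] by (auto simp: regular_def)
qed

text \<open>If two separations of the limit are not nested, each of the four inequalities between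
  their orientations fails at some index. Failure persists at larger indices because the bonding
  maps preserve order, so at a common bound all four fail, contrary to nestedness there.\<close>

lemma nested_inverse_limit:
  assumes sys: "inverse_system P le S f" and nest: "\<And>p. p \<in> P \<Longrightarrow> nested (S p)"
  shows "nested (inverse_limit P le S f)"
proof -
  let ?L = "inverse_limit P le S f"
  note L = separation_systemD[OF separation_system_inverse_limit[OF sys]]
  have "nested_seps ?L (unoriented ?L x) (unoriented ?L y)"
    if xy: "x \<in> seps ?L" "y \<in> seps ?L" for x y
  proof (rule ccontr)
    assume non: "\<not> ?thesis"
    let ?A = "unoriented ?L x \<times> unoriented ?L y"
    have A: "u \<in> seps ?L \<and> v \<in> seps ?L" if "(u, v) \<in> ?A" for u v
      using that xy L(4) by (auto simp: unoriented_def)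
    have "\<exists>p\<in>P. \<not> sep_le (S p) (fst c p) (snd c p)" if "c \<in> ?A" for c
      using non that by (auto simp: nested_seps_def le_inverse_limit)
    \<comment> \<open>\<open>b c\<close> is an index at which the pair \<open>c\<close> of
      orientations fails to be ordered.\<close>
    then obtain b where b: "\<And>c. c \<in> ?A \<Longrightarrow> b c \<in> P \<and> \<not> sep_le (S (b c)) (fst c (b c)) (snd c (b c))"
      by metis
    have "\<exists>t\<in>P. \<forall>p\<in>b ` ?A. le p t"
    proof (rule directed_poset_finite_bound[OF inverse_systemD(1)[OF sys]])
      show "finite (b ` ?A)" by (simp add: unoriented_def)
    qed (use b in blast)
    then obtain t where t: "t \<in> P" "\<And>c. c \<in> ?A \<Longrightarrow> le (b c) t" by auto
    have no: "\<not> sep_le (S t) (u t) (v t)" if uv: "(u, v) \<in> ?A" for u v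
    proof
      assume *: "sep_le (S t) (u t) (v t)"
      let ?p = "b (u, v)"
      have p: "?p \<in> P" "le ?p t" using b t uv by blast+
      have "u t \<in> seps (S t)" "v t \<in> seps (S t)"
        using A[OF uv] t(1) by (auto simp: seps_inverse_limit)
      \<comment> \<open>An inequality at \<open>t\<close> would descend along the bonding map to the
        index where it is known to fail.\<close>
      then have "sep_le (S ?p) (f t ?p (u t)) (f t ?p (v t))"
        using sep_homD(3)[OF inverse_systemD(4)[OF sys]] * p t(1) by blast
      then have "sep_le (S ?p) (u ?p) (v ?p)"
        using A[OF uv] p t(1) by (auto simp: seps_inverse_limit)
      then show False using b[OF uv] by simp
    qed
    have "x t \<in> seps (S t)" "y t \<in> seps (S t)"
      using xy t(1) by (auto simp: seps_inverse_limit)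
    then have "nested_seps (S t) {x t, star (S t) (x t)} {y t, star (S t) (y t)}"
      using nest[OF t(1)] by (auto simp: nested_def unoriented_def)
    \<comment> \<open>Every orientation of \<open>z t\<close> is the coordinate of an orientation of
      \<open>z\<close>, so an inequality in \<open>S t\<close> comes from one of the four
      pairs.\<close>
    moreover have "{z t, star (S t) (z t)} = (\<lambda>u. u t) ` unoriented ?L z" for z
      using t(1) by (auto simp: unoriented_def star_inverse_limit)
    ultimately obtain u v where "(u, v) \<in> ?A" "sep_le (S t) (u t) (v t)"
      unfolding nested_seps_def by auto
    then show False using no by blast
  qed
  then show ?thesis by (simp add: nested_def)
qed

section \<open>Passing to regular and nested systems\<close>

text \<open>Homomorphisms preserve smallness, so the small elements form an inverse system of finite
  sets whose limit points are small elements of the limit. The same fact carries regularity from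
  \<open>p\<close> up to every \<open>q\<close> above it: a small element of \<open>S q\<close>
  would map to one of \<open>S p\<close>.\<close>

lemma eventually_regular:
  assumes sys: "inverse_system P le S f" and reg: "regular (inverse_limit P le S f)"
  obtains p where "p \<in> P" "\<And>q. \<lbrakk>q \<in> P; le p q\<rbrakk> \<Longrightarrow> regular (S q)"
proof -
  note H = inverse_systemD[OF sys]
  have hom: "f q p x \<in> seps (S p) \<and> small (S p) (f q p x)"
    if "p \<in> P" "q \<in> P" "le p q" "x \<in> seps (S q)" "small (S q) x" for p q x
    using small_hom[OF H(4) H(2)] sep_homD(1)[OF H(4)] that by blast
  have "\<exists>p\<in>P. regular (S p)"
  proof (rule ccontr)
    assume non: "\<not> ?thesis"
    define X where "X p = {x \<in> seps (S p). small (S p) x}" for p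
    obtain x where x: "x \<in> (\<Pi>\<^sub>E p\<in>P. X p)"
        "\<And>p q. \<lbrakk>p \<in> P; q \<in> P; le p q\<rbrakk> \<Longrightarrow> f q p (x q) = x p"
    proof (rule finite_inverse_limit_nonempty[OF H(1), of X f])
      show "X p \<noteq> {}" if "p \<in> P" for p
        using non that by (auto simp: X_def regular_def)
    qed (use H(3,6) hom in \<open>auto simp: X_def\<close>)
    then have "x \<in> seps (inverse_limit P le S f)" "small (inverse_limit P le S f) x"
      by (auto simp: seps_inverse_limit small_def le_inverse_limit star_inverse_limit X_def PiE_iff)
    then show False using reg by (simp add: regular_def)
  qed
  then obtain p where p: "p \<in> P" "regular (S p)" by blast
  have "regular (S q)" if "q \<in> P" "le p q" for q
    using hom[OF p(1) that] p(2) by (auto simp: regular_def)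
  with p(1) show thesis by (rule that)
qed

text \<open>Each carrier keeps every value attained by a family in the limit, so no family is lost;
  order and involution are untouched. The limits are therefore equal, not merely isomorphic.\<close>

lemma inverse_limit_projections:
  "inverse_limit P le (\<lambda>p. S p\<lparr>seps := (\<lambda>x. x p) ` seps (inverse_limit P le S f)\<rparr>) f =
   inverse_limit P le S f" (is "inverse_limit P le ?S f = _")
proof -
  have "seps (inverse_limit P le ?S f) = seps (inverse_limit P le S f)"
    by (auto 0 3 simp: seps_inverse_limit PiE_iff)
  then show ?thesis by (simp add: inverse_limit_def)
qed

lemma inverse_system_projections:
  assumes sys: "inverse_system P le S f"
  shows "inverse_system P le (\<lambda>p. S p\<lparr>seps := (\<lambda>x. x p) ` seps (inverse_limit P le S f)\<rparr>) f"
proof -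
  let ?L = "inverse_limit P le S f"
  note H = inverse_systemD[OF sys]
  note L = separation_systemD[OF separation_system_inverse_limit[OF sys]]
  have sub: "(\<lambda>x. x p) ` seps ?L \<subseteq> seps (S p)" if "p \<in> P" for p
    using that by (auto simp: seps_inverse_limit)
  \<comment> \<open>The projection is closed under the involution because the limit is, with
    coordinatewise involution.\<close>
  have "star (S p) y \<in> (\<lambda>x. x p) ` seps ?L" if "p \<in> P" and y: "y \<in> (\<lambda>x. x p) ` seps ?L" for p y
  proof -
    obtain x where x: "x \<in> seps ?L" "y = x p" using y by blast
    then have "star (S p) y = star ?L x p" using that(1) by (simp add: star_inverse_limit)
    then show ?thesis using L(4)[OF x(1)] by blast
  qed
  then have sep: "separation_system (S p\<lparr>seps := (\<lambda>x. x p) ` seps ?L\<rparr>)" if "p \<in> P" for p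
    by (intro separation_system_subset H(2) sub that) (use that in blast)+
  moreover have "sep_hom (S q\<lparr>seps := (\<lambda>x. x q) ` seps ?L\<rparr>) (S p\<lparr>seps := (\<lambda>x. x p) ` seps ?L\<rparr>) (f q p)"
    if pq: "p \<in> P" "q \<in> P" "le p q" for p q
  proof -
    \<comment> \<open>By compatibility, \<open>f q p (x q)\<close> is the coordinate
      \<open>x p\<close> of the same family.\<close>
    have "f q p (x q) \<in> (\<lambda>x. x p) ` seps ?L" if "x \<in> seps ?L" for x
      using that pq by (auto simp: seps_inverse_limit)
    then show ?thesis
      using H(4)[OF pq] sub[OF pq(2)] unfolding sep_hom_def by (auto 0 3 simp: subset_iff)
  qed
  moreover have "finite ((\<lambda>x. x p) ` seps ?L)" if "p \<in> P" for p
    using finite_subset[OF sub[OF that] H(3)[OF that]] .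
  ultimately show ?thesis
    using H(1) H(5,6) sub unfolding inverse_system_def by (simp add: subset_iff)
qed

lemma inverse_system_subset:
  assumes "inverse_system P le S f" "Q \<subseteq> P" "directed_poset Q le"
  shows "inverse_system Q le S f"
  using assms unfolding inverse_system_def by (simp add: subset_iff)

text \<open>Restriction to \<open>Q\<close> is the isomorphism: the coordinate at any
  \<open>p\<close> is recovered by applying a bonding map to the coordinate at some index of
  \<open>Q\<close> above \<open>p\<close>. This also makes restriction reflect the order.\<close>

lemma isomorphic_inverse_limit_cofinal:
  assumes sys: "inverse_system P le S f" and QP: "Q \<subseteq> P" and Q: "directed_poset Q le"
    and cof: "\<And>p. p \<in> P \<Longrightarrow> \<exists>q\<in>Q. le p q"
  shows "isomorphic (inverse_limit P le S f) (inverse_limit Q le S f)"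
proof -
  let ?L = "inverse_limit P le S f" and ?M = "inverse_limit Q le S f"
  note H = inverse_systemD[OF sys]
  obtain c where c: "\<And>p. p \<in> P \<Longrightarrow> c p \<in> Q" "\<And>p. p \<in> P \<Longrightarrow> le p (c p)"
    using cof by metis
  then have cP: "\<And>p. p \<in> P \<Longrightarrow> c p \<in> P" using QP by blast
  have rec: "x p = f (c p) p (x (c p))" if "x \<in> seps ?L" "p \<in> P" for x p
    using that c(2) cP by (simp add: seps_inverse_limit)
  have memL: "x p \<in> seps (S p)" if "x \<in> seps ?L" "p \<in> P" for x p
    using that by (auto simp: seps_inverse_limit)
  have maps: "restrict x Q \<in> seps ?M" if "x \<in> seps ?L" for x
    using that QP by (auto simp: seps_inverse_limit subset_iff)
  have inj: "inj_on (\<lambda>x. restrict x Q) (seps ?L)"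
  proof (rule inj_onI)
    fix x y assume xy: "x \<in> seps ?L" "y \<in> seps ?L" "restrict x Q = restrict y Q"
    then have eq: "x q = y q" if "q \<in> Q" for q
      using that by (metis restrict_apply')
    have "x p = y p" if "p \<in> P" for p
      using rec xy that eq c(1) by metis
    then show "x = y"
      using xy by (intro PiE_ext[of x P "\<lambda>p. seps (S p)" y]) (auto simp: seps_inverse_limit)
  qed
  have surj: "\<exists>x\<in>seps ?L. y = restrict x Q" if y: "y \<in> seps ?M" for y
  proof -
    have yS: "y q \<in> seps (S q)" if "q \<in> Q" for q
      using y that by (auto simp: seps_inverse_limit)
    have yf: "f q p (y q) = y p" if "p \<in> Q" "q \<in> Q" "le p q" for p q
      using y that by (auto simp: seps_inverse_limit)
    \<comment> \<open>The value sent down to \<open>p\<close> does not depend on the index of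
      \<open>Q\<close> above \<open>p\<close>: two choices are compared through a common bound in
      \<open>Q\<close>.\<close>
    have indep: "f q p (y q) = f r p (y r)"
      if qr: "q \<in> Q" "r \<in> Q" "le p q" "le p r" "p \<in> P" for p q r
    proof -
      obtain t where t: "t \<in> Q" "le q t" "le r t"
        using directed_posetD(4)[OF Q] qr by blast
      have "f q p (f t q (y t)) = f t p (y t)" "f r p (f t r (y t)) = f t p (y t)"
        using H(6) qr t yS QP by blast+
      then show ?thesis using yf t qr by simp
    qed
    define x where "x = (\<lambda>p\<in>P. f (c p) p (y (c p)))"
    have "f q p (x q) = x p" if "p \<in> P" "q \<in> P" "le p q" for p q
    proof -
      \<comment> \<open>The choices \<open>c p\<close> and \<open>c q\<close> need not be
        comparable, but both lie above \<open>p\<close>, so \<open>indep\<close> applies.\<close>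
      have "le p (c q)"
        using directed_posetD(3)[OF H(1)] that c(2) cP by blast
      have "f q p (x q) = f (c q) p (y (c q))"
        using that H(6)[of p q "c q"] c cP yS by (simp add: x_def)
      also have "\<dots> = x p"
        using indep \<open>le p (c q)\<close> c that by (simp add: x_def)
      finally show ?thesis .
    qed
    moreover have "x \<in> (\<Pi>\<^sub>E p\<in>P. seps (S p))"
      using sep_homD(1)[OF H(4)] c cP yS by (auto simp: x_def)
    ultimately have "x \<in> seps ?L" by (simp add: seps_inverse_limit)
    moreover have "y = restrict x Q"
    proof (rule PiE_ext)
      show "y \<in> (\<Pi>\<^sub>E p\<in>Q. seps (S p))" using y by (simp add: seps_inverse_limit)
      show "restrict x Q \<in> (\<Pi>\<^sub>E p\<in>Q. seps (S p))"
        using maps[OF \<open>x \<in> seps ?L\<close>] by (simp add: seps_inverse_limit)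
      \<comment> \<open>Here \<open>c q\<close> may differ from \<open>q\<close>; compatibility of
        \<open>y\<close> on \<open>Q\<close> still returns \<open>y q\<close>.\<close>
      show "y q = restrict x Q q" if "q \<in> Q" for q
        using that QP yf c by (auto simp: x_def)
    qed
    ultimately show ?thesis by blast
  qed
  have "bij_betw (\<lambda>x. restrict x Q) (seps ?L) (seps ?M)"
    using inj maps surj by (auto simp: bij_betw_def)
  moreover have "restrict (star ?L x) Q = star ?M (restrict x Q)" for x
    using QP by (auto simp: star_inverse_limit fun_eq_iff)
  moreover have "sep_le ?L x y \<longleftrightarrow> sep_le ?M (restrict x Q) (restrict y Q)"
    if xy: "x \<in> seps ?L" "y \<in> seps ?L" for x y
  proof -
    \<comment> \<open>The inequality at \<open>c p\<close> descends to \<open>p\<close>.\<close>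
    have "sep_le (S p) (x p) (y p)" if "p \<in> P" "\<forall>q\<in>Q. sep_le (S q) (x q) (y q)" for p
      using sep_homD(3)[OF H(4)[OF \<open>p \<in> P\<close> cP c(2)]] rec xy that memL cP c(1) by metis
    then show ?thesis using QP by (auto simp: le_inverse_limit)
  qed
  ultimately show ?thesis
    unfolding isomorphic_iff[OF separation_system_inverse_limit[OF sys]] by blast
qed

section \<open>The two halves of the theorem\<close>

text \<open>Nestedness is carried forward by \<open>g\<close>, regularity by the inverse of
  \<open>g\<close>, which would send a small element of \<open>S\<close> to one of
  \<open>T\<close>.\<close>

lemma isomorphic_regular_nested:
  assumes iso: "isomorphic T S" and T: "separation_system T" "nested T" "regular T"
  shows "nested S" "regular S"
proof -
  obtain g where g: "bij_betw g (seps T) (seps S)" "sep_hom T S g"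
      "sep_hom S T (inv_into (seps T) g)"
    using iso by (auto simp: isomorphic_def)
  have im: "g ` seps T = seps S" using g(1) by (simp add: bij_betw_def)
  show "nested S"
    using nested_hom_image[OF g(2) T(1,2)] im by simp
  show "regular S"
    unfolding regular_def
  proof (intro ballI notI)
    fix s assume "s \<in> seps S" "small S s"
    let ?h = "inv_into (seps T) g"
    \<comment> \<open>No axioms are assumed for \<open>S\<close>, so closure under the involution is
      transported from \<open>T\<close>.\<close>
    have "star S s \<in> seps S"
      using \<open>s \<in> seps S\<close> sep_homD(1,2)[OF g(2)] separation_systemD(4)[OF T(1)] im
      by (metis imageE)
    then have "small T (?h s)"
      using \<open>small S s\<close> \<open>s \<in> seps S\<close> sep_homD(2,3)[OF g(3)] unfolding small_def by metis
    then show False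
      using T(3) sep_homD(1)[OF g(3) \<open>s \<in> seps S\<close>] by (simp add: regular_def)
  qed
qed

lemma regular_tree_set_inverse_limit:
  assumes sys: "inverse_system P le S f" and "\<And>p. p \<in> P \<Longrightarrow> tree_set (S p) \<and> regular (S p)"
  shows "tree_set (inverse_limit P le S f) \<and> regular (inverse_limit P le S f)"
  using assms
  by (meson regular_inverse_limit nested_inverse_limit regular_nested_tree_set
      separation_system_inverse_limit tree_set_def)

text \<open>Only the index set and the carriers shrink; the bonding maps \<open>f\<close> stay the
  same. The carriers are first cut down to the projections, for nestedness, and the indices then
  restricted to those above \<open>p\<close>, for regularity.\<close>

lemma regular_profinite_tree_set:
  fixes T :: "'a sepsys" and S :: "'i \<Rightarrow> 'b sepsys"
  assumes T: "tree_set T" "regular T"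
    and sys: "inverse_system P le S f" and iso: "isomorphic T (inverse_limit P le S f)"
  shows "\<exists>Q (R :: 'i \<Rightarrow> 'b sepsys). inverse_system Q le R f \<and>
           (\<forall>q\<in>Q. tree_set (R q) \<and> regular (R q)) \<and> isomorphic T (inverse_limit Q le R f)"
proof -
  let ?L = "inverse_limit P le S f"
  define R where "R p = S p\<lparr>seps := (\<lambda>x. x p) ` seps ?L\<rparr>" for p
  have T': "separation_system T" "nested T"
    using T(1) by (auto simp: tree_set_def)
  have L: "separation_system ?L" "nested ?L" "regular ?L"
    using separation_system_inverse_limit[OF sys] isomorphic_regular_nested[OF iso T' T(2)] by auto
  obtain p where p: "p \<in> P" "\<And>q. \<lbrakk>q \<in> P; le p q\<rbrakk> \<Longrightarrow> regular (S q)"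
    using eventually_regular[OF sys L(3)] by blast
  define Q where "Q = {q \<in> P. le p q}"
  have P: "directed_poset P le" using inverse_systemD(1)[OF sys] .
  have Q: "Q \<subseteq> P" "directed_poset Q le"
    using directed_poset_above[OF P p(1)] by (auto simp: Q_def)
  have cof: "\<exists>q\<in>Q. le r q" if "r \<in> P" for r
    using directed_posetD(4)[OF P p(1) that] by (auto simp: Q_def)
  have sysR: "inverse_system P le R f"
    using inverse_system_projections[OF sys] by (simp add: R_def[abs_def])
  have sysQ: "inverse_system Q le R f"
    using inverse_system_subset[OF sysR Q] .
  have "isomorphic T (inverse_limit P le R f)"
    using iso inverse_limit_projections[of P le S f] by (simp add: R_def[abs_def])
  then have "isomorphic T (inverse_limit Q le R f)"
    using isomorphic_trans[OF T'(1) separation_system_inverse_limit[OF sysR]]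
      isomorphic_inverse_limit_cofinal[OF sysR Q cof] by blast
  moreover have "tree_set (R q) \<and> regular (R q)" if "q \<in> Q" for q
  proof -
    have q: "q \<in> P" "regular (S q)" using that p(2) by (auto simp: Q_def)
    \<comment> \<open>\<open>R q\<close> has the order and involution of \<open>S q\<close> on a
      smaller carrier, so it inherits regularity.\<close>
    have "regular (R q)"
      using q sep_homD(1)[OF sep_hom_projection]
      by (fastforce simp: regular_def small_def R_def)
    moreover have "nested (R q)"
      using nested_hom_image[OF sep_hom_projection[OF q(1)] L(1,2)] by (simp add: R_def)
    ultimately show ?thesis
      using regular_nested_tree_set inverse_systemD(2)[OF sysR q(1)] by blast
  qed
  ultimately show ?thesis using sysQ by blast
qed

theorem theorem3p2:
  "(\<forall>(P :: 'j set) le (S :: 'j \<Rightarrow> 'c sepsys) f.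
      inverse_system P le S f \<and> (\<forall>p\<in>P. tree_set (S p) \<and> regular (S p)) \<longrightarrow>
      tree_set (inverse_limit P le S f) \<and> regular (inverse_limit P le S f)) \<and>
   (\<forall>T :: 'a sepsys.
      tree_set T \<and> regular T \<and> profinite TYPE('i) TYPE('b) T \<longrightarrow>
      (\<exists>(P :: 'i set) le (S :: 'i \<Rightarrow> 'b sepsys) f.
         inverse_system P le S f \<and> (\<forall>p\<in>P. tree_set (S p) \<and> regular (S p)) \<and>
         isomorphic T (inverse_limit P le S f)))"
proof (intro conjI allI impI)
  fix P :: "'j set" and le and S :: "'j \<Rightarrow> 'c sepsys" and f
  assume "inverse_system P le S f \<and> (\<forall>p\<in>P. tree_set (S p) \<and> regular (S p))"
  then show "tree_set (inverse_limit P le S f)" "regular (inverse_limit P le S f)"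
    using regular_tree_set_inverse_limit[of P le S f] by blast+
next
  fix T :: "'a sepsys"
  assume T: "tree_set T \<and> regular T \<and> profinite TYPE('i) TYPE('b) T"
  then obtain P :: "'i set" and le and S :: "'i \<Rightarrow> 'b sepsys" and f
    where "inverse_system P le S f" "isomorphic T (inverse_limit P le S f)"
    unfolding profinite_def by blast
  with T show "\<exists>(P :: 'i set) le (S :: 'i \<Rightarrow> 'b sepsys) f.
         inverse_system P le S f \<and> (\<forall>p\<in>P. tree_set (S p) \<and> regular (S p)) \<and>
         isomorphic T (inverse_limit P le S f)"
    using regular_profinite_tree_set[of T P le S f] by blast
qed

end
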